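(* Let $(u_0^{(j)})_{j=1,\dots,J}$ be an initial particle system in $\Omega$, and let $(u_t^{(j)},t\ge0)$, $j=1,\dots,J$, be a solution of the inflated constrained EKI flow. Then for all $t\ge0$ $$V_e(t)\le\frac{1}{\frac{2\sigma_{min}}{J}t+V_e(0)^{-1}}.$$
   Context: Setting: $X=\mathbb{R}^d$, $G:X\to\mathbb{R}^K$ is a (possibly nonlinear) forward map, $y\in\mathbb{R}^K$ is given data, $\Gamma\in\mathbb{R}^{K\times K}$ and $C_0\in\mathbb{R}^{d\times d}$ are symmetric positive definite. $\Omega=\{u\in X: h_i(u)\le0,\ i=1,\dots,m\}$, where each $h_i:X\to\mathbb{R}$ is convex and continuously differentiable and there exists $u\in X$ with $h_i(u)<0$ for all $i$. $\tau>0$ is a penalty parameter and $\|\cdot\|$ is the Euclidean norm. Ensemble notation: for particles $u_t=(u_t^{(j)})_{j=1,\dots,J}$ in $X$, $J\ge2$, put $\bar u_t=\frac1J\sum_j u_t^{(j)}$, $\bar G(u_t)=\frac1J\sum_jG(u_t^{(j)})$, $\widehat C(u_t)=\frac1J\sum_j(u_t^{(j)}-\bar u_t)(u_t^{(j)}-\bar u_t)^T$, $\widehat C_t^{u,G}=\frac1J\sum_j(u_t^{(j)}-\bar u_t)(G(u_t^{(j)})-\bar G(u_t))^T$. Inflated constrained EKI flow: for $j=1,\dots,J$, $$\frac{\mathrm{d}u_t^{(j)}}{\mathrm{d}t}=-\widehat C_t^{u,G}\Gamma^{-1}(G(u_t^{(j)})-y)-\widehat C(u_t)C_0^{-1}u_t^{(j)}+\rho_t\,\widehat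 C_t^{u,G}\Gamma^{-1}(G(u_t^{(j)})-\bar G(u_t))+\frac1\tau\widehat C(u_t)\sum_{i=1}^m\frac{1}{h_i(\bar u_t)}\nabla h_i(\bar u_t),$$ where the covariance inflation factor satisfies $0\le\rho_t\le1$ for all $t\ge0$ and $\rho_t\to1$ as $t\to\infty$. $V_e(t)=\frac1J\sum_{j=1}^J\frac12\|u_t^{(j)}-\bar u_t\|^2$, with $V_e(0)>0$ so that $V_e(0)^{-1}$ makes sense. $\sigma_{min}$ is the smallest eigenvalue of $C_0^{-1}$. *)

theory Defs
  imports "HOL-Analysis.Analysis"
begin

definition outer :: "real ^ 'm \<Rightarrow> real ^ 'n \<Rightarrow> real ^ 'n ^ 'm" where
  "outer v w = (\<chi> i j. v $ i * w $ j)"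

definition symmetric_pos_def :: "real ^ 'n ^ 'n \<Rightarrow> bool" where
  "symmetric_pos_def A \<longleftrightarrow> transpose A = A \<and> (\<forall>x. x \<noteq> 0 \<longrightarrow> x \<bullet> (A *v x) > 0)"

definition is_eigenvalue :: "real ^ 'n ^ 'n \<Rightarrow> real \<Rightarrow> bool" where
  "is_eigenvalue A l \<longleftrightarrow> (\<exists>v. v \<noteq> 0 \<and> A *v v = l *\<^sub>R v)"

text \<open>A real symmetric matrix has a nonempty finite set of (real) eigenvalues, so the least one
  exists; for other matrices the value may be meaningless.\<close>

definition min_eigenvalue :: "real ^ 'n ^ 'n \<Rightarrow> real" where
  "min_eigenvalue A = (LEAST l. is_eigenvalue A l)"

definition grad :: "('a::euclidean_space \<Rightarrow> real) \<Rightarrow> 'a \<Rightarrow> 'a" where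
  "grad f x = (THE D. GDERIV f x :> D)"

definition continuously_differentiable :: "('a::euclidean_space \<Rightarrow> real) \<Rightarrow> bool" where
  "continuously_differentiable f \<longleftrightarrow>
     (\<forall>x. f differentiable (at x)) \<and> continuous_on UNIV (grad f)"

text \<open>Constraint functions and particles are indexed by natural numbers; only the indices
  in \<open>{1..m}\<close> and \<open>{1..J}\<close>, respectively, are meaningful.\<close>

definition feasible_set :: "nat \<Rightarrow> (nat \<Rightarrow> 'a \<Rightarrow> real) \<Rightarrow> 'a set" where
  "feasible_set m h = {u. \<forall>i\<in>{1..m}. h i u \<le> 0}"

definition ens_mean :: "nat \<Rightarrow> (nat \<Rightarrow> 'a::real_vector) \<Rightarrow> 'a" where
  "ens_mean J v = (1 / real J) *\<^sub>R (\<Sum>j=1..J. v j)"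

definition ens_cross_cov ::
    "nat \<Rightarrow> (nat \<Rightarrow> real ^ 'd) \<Rightarrow> (nat \<Rightarrow> real ^ 'k) \<Rightarrow> real ^ 'k ^ 'd" where
  "ens_cross_cov J v w =
     (1 / real J) *\<^sub>R (\<Sum>j=1..J. outer (v j - ens_mean J v) (w j - ens_mean J w))"

definition ens_cov :: "nat \<Rightarrow> (nat \<Rightarrow> real ^ 'd) \<Rightarrow> real ^ 'd ^ 'd" where
  "ens_cov J v = ens_cross_cov J v v"

definition ens_spread :: "nat \<Rightarrow> (nat \<Rightarrow> real ^ 'd) \<Rightarrow> real" where
  "ens_spread J v = (1 / real J) * (\<Sum>j=1..J. (1 / 2) * (norm (v j - ens_mean J v))\<^sup>2)"

text \<open>The drift of particle \<open>j\<close> when the ensemble is \<open>v\<close> and the inflation factor is \<open>r\<close>.\<close>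

definition eki_drift ::
    "(real ^ 'd \<Rightarrow> real ^ 'k) \<Rightarrow> real ^ 'k \<Rightarrow> real ^ 'k ^ 'k \<Rightarrow> real ^ 'd ^ 'd \<Rightarrow> real \<Rightarrow>
     nat \<Rightarrow> (nat \<Rightarrow> real ^ 'd \<Rightarrow> real) \<Rightarrow> nat \<Rightarrow> real \<Rightarrow> (nat \<Rightarrow> real ^ 'd) \<Rightarrow> nat \<Rightarrow> real ^ 'd" where
  "eki_drift G y \<Gamma> C0 \<tau> m h J r v j =
     (let vbar = ens_mean J v;
          Gbar = ens_mean J (\<lambda>l. G (v l));
          C = ens_cov J v;
          CuG = ens_cross_cov J v (\<lambda>l. G (v l))
      in - (CuG *v (matrix_inv \<Gamma> *v (G (v j) - y)))
         - C *v (matrix_inv C0 *v v j)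
         + r *\<^sub>R (CuG *v (matrix_inv \<Gamma> *v (G (v j) - Gbar)))
         + (1 / \<tau>) *\<^sub>R (C *v (\<Sum>i=1..m. (1 / h i vbar) *\<^sub>R grad (h i) vbar)))"

text \<open>In HOL \<open>1 / 0 = 0\<close>; the first conjunct states that the right-hand side of the flow is
  defined along a solution. At \<open>t = 0\<close> the derivative is one-sided.\<close>

definition eki_solution ::
    "(real ^ 'd \<Rightarrow> real ^ 'k) \<Rightarrow> real ^ 'k \<Rightarrow> real ^ 'k ^ 'k \<Rightarrow> real ^ 'd ^ 'd \<Rightarrow> real \<Rightarrow>
     nat \<Rightarrow> (nat \<Rightarrow> real ^ 'd \<Rightarrow> real) \<Rightarrow> nat \<Rightarrow> (real \<Rightarrow> real) \<Rightarrow>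
     (real \<Rightarrow> nat \<Rightarrow> real ^ 'd) \<Rightarrow> bool" where
  "eki_solution G y \<Gamma> C0 \<tau> m h J \<rho> u \<longleftrightarrow>
     (\<forall>t\<ge>0.
        (\<forall>i\<in>{1..m}. h i (ens_mean J (u t)) \<noteq> 0) \<and>
        (\<forall>j\<in>{1..J}.
           ((\<lambda>s. u s j) has_vector_derivative eki_drift G y \<Gamma> C0 \<tau> m h J (\<rho> t) (u t) j)
             (at t within {0..})))"

end

theory Submission
  imports Defs
begin

text \<open>
  Let \<open>e\<^sub>j\<close> be the deviation of particle \<open>j\<close> from the ensemble mean and \<open>g\<^sub>j\<close> that of its image
  under \<open>G\<close>. Every part of the drift that is the same for all particles moves only the mean, and
  the deviations sum to zero, so the data, the constraints and the mean itself drop out of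
  the derivative of the spread \<open>V\<close>. What is left are the two sums
  \<open>-((1 - \<rho>) / J\<^sup>2) \<Sum>\<^bsub>j,l\<^esub> (e\<^sub>l \<bullet> e\<^sub>j) (g\<^sub>l \<bullet> \<Gamma>\<inverse> g\<^sub>j)\<close> and
  \<open>-(1 / J\<^sup>2) \<Sum>\<^bsub>j,l\<^esub> (e\<^sub>l \<bullet> e\<^sub>j) (e\<^sub>l \<bullet> C\<^sub>0\<inverse> e\<^sub>j)\<close>.

  The Gram matrix of the \<open>e\<^sub>j\<close> is positive semidefinite, so such a sum inherits lower
  bounds of the quadratic form (\<open>gram_weighted_form_ge\<close>). Positivity of \<open>\<Gamma>\<inverse>\<close> and
  \<open>\<rho> \<le> 1\<close> thus make the first term nonpositive: inflation may weaken the contraction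
  caused by the data, but it never reverses it. The Rayleigh bound
  (\<open>min_eigenvalue_props\<close>), with \<open>\<sigma>\<close> the least eigenvalue of \<open>C\<^sub>0\<inverse>\<close>, makes the second at most
  \<open>-(\<sigma> / J\<^sup>2) \<Sum>\<^bsub>j,l\<^esub> (e\<^sub>l \<bullet> e\<^sub>j)\<^sup>2\<close>. Keeping only the diagonal and using
  the Cauchy-Schwarz inequality gives \<open>V' \<le> -(4 \<sigma> / J) V\<^sup>2\<close>, and comparison with the
  explicitly solvable Riccati equation (\<open>riccati_comparison\<close>) gives the decay, with \<open>4 \<sigma> / J\<close>
  in place of the asserted rate \<open>2 \<sigma> / J\<close>.
\<close>

section \<open>Symmetric positive definite matrices and the least eigenvalue\<close>

lemma symmetric_pos_def_invertible:
  fixes A :: "real ^ 'n ^ 'n"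
  assumes "symmetric_pos_def A"
  shows "invertible A"
proof -
  have "x = 0" if "A *v x = 0" for x
    using assms that unfolding symmetric_pos_def_def by force
  then show ?thesis
    by (auto simp: invertible_left_inverse matrix_left_invertible_ker)
qed

lemma symmetric_pos_def_inv:
  fixes A :: "real ^ 'n ^ 'n"
  assumes "symmetric_pos_def A"
  shows "symmetric_pos_def (matrix_inv A)"
proof -
  have inv: "A ** matrix_inv A = mat 1" "matrix_inv A ** A = mat 1"
    using someI_ex[OF symmetric_pos_def_invertible[OF assms, unfolded invertible_def]]
    by (simp_all add: matrix_inv_def)
  have sym: "transpose A = A"
    using assms by (simp add: symmetric_pos_def_def)
  have "transpose (matrix_inv A) ** A = mat 1"
    using inv(1) sym by (metis matrix_transpose_mul transpose_mat)
  then have "transpose (matrix_inv A) = matrix_inv A"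
    using inv(1) by (metis matrix_mul_assoc matrix_mul_lid matrix_mul_rid)
  moreover have "x \<bullet> (matrix_inv A *v x) > 0" if "x \<noteq> 0" for x
  proof -
    define z where "z = matrix_inv A *v x"
    have x: "x = A *v z"
      by (simp add: z_def matrix_vector_mul_assoc inv)
    then have "z \<noteq> 0"
      using that by auto
    then have "z \<bullet> (A *v z) > 0"
      using assms by (simp add: symmetric_pos_def_def)
    then show ?thesis
      by (metis x z_def inner_commute)
  qed
  ultimately show ?thesis
    by (simp add: symmetric_pos_def_def)
qed

lemma linear_coefficient_zero:
  fixes a b :: real
  assumes "\<And>s. 0 \<le> 2 * s * b + s\<^sup>2 * a"
  shows "b = 0"
proof (rule ccontr)
  assume "b \<noteq> 0"
  \<comment> \<open>At \<open>s = - b / k\<close> with \<open>k\<close> large the linear term, which is negative there, dominates.\<close>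
  define k where "k = \<bar>a\<bar> + 1"
  have k: "k > 0" "a < k"
    by (auto simp: k_def)
  have "2 * (- b / k) * b + (- b / k)\<^sup>2 * a = (b / k)\<^sup>2 * (a - 2 * k)"
    using k by (simp add: field_simps power2_eq_square)
  also have "\<dots> < 0"
    using k \<open>b \<noteq> 0\<close> by (intro mult_pos_neg) auto
  finally show False
    using assms[of "- b / k"] by simp
qed

text \<open>On the unit sphere the quadratic form attains a minimum \<open>l\<close> at some \<open>v\<close>. The form of
  \<open>A - l\<close> is then nonnegative and vanishes at \<open>v\<close>, so its first variation there vanishes too;
  by symmetry this says that \<open>v\<close> is an eigenvector.\<close>

lemma symmetric_min_eigenpair:
  fixes A :: "real ^ 'n ^ 'n"
  assumes sym: "transpose A = A"
  obtains l where "is_eigenvalue A l" "\<And>x. l * (x \<bullet> x) \<le> x \<bullet> (A *v x)"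
proof -
  have "sphere (0::real^'n) 1 \<noteq> {}"
    by simp
  moreover have "continuous_on (sphere 0 1) (\<lambda>x. x \<bullet> (A *v x))"
    by (intro continuous_intros)
  ultimately obtain v where v: "v \<in> sphere 0 1"
    and vmin: "\<And>x. x \<in> sphere 0 1 \<Longrightarrow> v \<bullet> (A *v v) \<le> x \<bullet> (A *v x)"
    using continuous_attains_inf[OF compact_sphere, of 0 1 "\<lambda>x. x \<bullet> (A *v x)"] by metis
  define l where "l = v \<bullet> (A *v v)"
  have vv: "v \<bullet> v = 1"
    using v by (simp add: dot_square_norm)
  have ge: "l * (x \<bullet> x) \<le> x \<bullet> (A *v x)" for x
  proof (cases "x = 0")
    case False
    have "l \<le> (x /\<^sub>R norm x) \<bullet> (A *v (x /\<^sub>R norm x))"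
      unfolding l_def using False by (intro vmin) simp
    also have "\<dots> = (x \<bullet> (A *v x)) / (norm x)\<^sup>2"
      by (simp add: matrix_vector_mult_scaleR power2_eq_square divide_inverse)
    finally show ?thesis
      using False by (simp add: pos_le_divide_eq dot_square_norm)
  qed simp
  define r where "r = A *v v - l *\<^sub>R v"
  have "r \<bullet> r = 0"
  proof (rule linear_coefficient_zero)
    fix s :: real
    have swap: "v \<bullet> (A *v r) = r \<bullet> (A *v v)"
      by (metis dot_lmul_matrix inner_commute sym transpose_matrix_vector)
    have Av: "v \<bullet> (A *v v) = l"
      by (simp add: l_def)
    have rr: "r \<bullet> r = r \<bullet> (A *v v) - l * (r \<bullet> v)"
      by (simp add: r_def inner_diff_right inner_diff_left algebra_simps inner_commute)
    have "0 \<le> (v + s *\<^sub>R r) \<bullet> (A *v (v + s *\<^sub>R r)) - l * ((v + s *\<^sub>R r) \<bullet> (v + s *\<^sub>R r))"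
      using ge[of "v + s *\<^sub>R r"] by simp
    also have "\<dots> = 2 * s * (r \<bullet> (A *v v) - l * (r \<bullet> v)) +
        s\<^sup>2 * (r \<bullet> (A *v r) - l * (r \<bullet> r))"
      by (simp add: matrix_vector_right_distrib matrix_vector_mult_scaleR inner_add_left
          inner_add_right swap vv Av inner_commute[of v r] power2_eq_square algebra_simps)
    finally show "0 \<le> 2 * s * (r \<bullet> r) + s\<^sup>2 * (r \<bullet> (A *v r) - l * (r \<bullet> r))"
      by (simp only: rr)
  qed
  then have "A *v v = l *\<^sub>R v"
    by (simp add: r_def)
  moreover have "v \<noteq> 0"
    using vv by auto
  ultimately show ?thesis
    using that[of l] ge by (auto simp: is_eigenvalue_def)
qed

text \<open>An eigenvalue that bounds the quadratic form from below is the least one, so the minimum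
  of the form on the unit sphere is the value of \<^const>\<open>min_eigenvalue\<close>.\<close>

lemma min_eigenvalue_props:
  fixes A :: "real ^ 'n ^ 'n"
  assumes "symmetric_pos_def A"
  shows "min_eigenvalue A > 0"
    and "min_eigenvalue A * (x \<bullet> x) \<le> x \<bullet> (A *v x)"
proof -
  obtain l where l: "is_eigenvalue A l" and ge: "\<And>x. l * (x \<bullet> x) \<le> x \<bullet> (A *v x)"
    using assms symmetric_min_eigenpair by (auto simp: symmetric_pos_def_def)
  have "l \<le> k" if "is_eigenvalue A k" for k
  proof -
    from that obtain w where w: "w \<noteq> 0" "A *v w = k *\<^sub>R w"
      unfolding is_eigenvalue_def by blast
    then have "l * (w \<bullet> w) \<le> k * (w \<bullet> w)"
      using ge[of w] by simp
    then show ?thesis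
      using w(1) by simp
  qed
  then have eq: "min_eigenvalue A = l"
    unfolding min_eigenvalue_def using l by (intro Least_equality)
  from l obtain v where v: "v \<noteq> 0" "A *v v = l *\<^sub>R v"
    unfolding is_eigenvalue_def by blast
  then have "l * (v \<bullet> v) > 0"
    using assms by (metis inner_scaleR_right symmetric_pos_def_def)
  then show "min_eigenvalue A > 0"
    unfolding eq by (rule zero_less_mult_pos2) (simp add: v(1))
  show "min_eigenvalue A * (x \<bullet> x) \<le> x \<bullet> (A *v x)"
    using ge eq by simp
qed

section \<open>Sums weighted by a Gram matrix\<close>

text \<open>Expanding \<open>e l \<bullet> e j\<close> in an orthonormal basis turns the double sum into a sum of values
  of the quadratic form.\<close>

lemma gram_weighted_form:
  fixes e :: "'i \<Rightarrow> 'a::euclidean_space" and g :: "'i \<Rightarrow> 'b::real_inner"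
  assumes "linear P"
  shows "(\<Sum>j\<in>I. \<Sum>l\<in>I. (e l \<bullet> e j) * (g l \<bullet> P (g j))) =
    (\<Sum>b\<in>Basis. (\<Sum>l\<in>I. (e l \<bullet> b) *\<^sub>R g l) \<bullet> P (\<Sum>j\<in>I. (e j \<bullet> b) *\<^sub>R g j))"
proof -
  have "(\<Sum>b\<in>Basis. (\<Sum>l\<in>I. (e l \<bullet> b) *\<^sub>R g l) \<bullet> P (\<Sum>j\<in>I. (e j \<bullet> b) *\<^sub>R g j)) =
    (\<Sum>b\<in>Basis. \<Sum>j\<in>I. \<Sum>l\<in>I. (e l \<bullet> b) * (e j \<bullet> b) * (g l \<bullet> P (g j)))"
    by (simp add: linear_sum[OF assms] linear_scale[OF assms] inner_sum_left inner_sum_right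
        sum_distrib_left mult_ac)
  also have "\<dots> = (\<Sum>j\<in>I. \<Sum>b\<in>Basis. \<Sum>l\<in>I. (e l \<bullet> b) * (e j \<bullet> b) * (g l \<bullet> P (g j)))"
    by (rule sum.swap)
  also have "\<dots> = (\<Sum>j\<in>I. \<Sum>l\<in>I. \<Sum>b\<in>Basis. (e l \<bullet> b) * (e j \<bullet> b) * (g l \<bullet> P (g j)))"
    by (intro sum.cong refl sum.swap)
  also have "\<dots> = (\<Sum>j\<in>I. \<Sum>l\<in>I. (e l \<bullet> e j) * (g l \<bullet> P (g j)))"
    by (simp only: euclidean_inner[of "e _" "e _"] sum_distrib_right)
  finally show ?thesis ..
qed

lemma gram_weighted_form_ge:
  fixes e :: "'i \<Rightarrow> 'a::euclidean_space" and g :: "'i \<Rightarrow> 'b::real_inner"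
  assumes "linear P" and "\<And>x. c * (x \<bullet> x) \<le> x \<bullet> P x"
  shows "c * (\<Sum>j\<in>I. \<Sum>l\<in>I. (e l \<bullet> e j) * (g l \<bullet> g j)) \<le>
    (\<Sum>j\<in>I. \<Sum>l\<in>I. (e l \<bullet> e j) * (g l \<bullet> P (g j)))"
proof -
  have "c * (\<Sum>j\<in>I. \<Sum>l\<in>I. (e l \<bullet> e j) * (g l \<bullet> g j)) =
    (\<Sum>b\<in>Basis. c * ((\<Sum>l\<in>I. (e l \<bullet> b) *\<^sub>R g l) \<bullet> (\<Sum>j\<in>I. (e j \<bullet> b) *\<^sub>R g j)))"
    using gram_weighted_form[OF linear_ident, of e g I] by (simp add: sum_distrib_left)
  also have "\<dots> \<le> (\<Sum>b\<in>Basis. (\<Sum>l\<in>I. (e l \<bullet> b) *\<^sub>R g l) \<bullet> P (\<Sum>j\<in>I. (e j \<bullet> b) *\<^sub>R g j))"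
    by (intro sum_mono assms(2))
  finally show ?thesis
    by (simp only: gram_weighted_form[OF assms(1)])
qed

text \<open>The diagonal entries alone suffice: the Cauchy-Schwarz inequality bounds the square of the
  trace of the Gram matrix by the sum of their squares.\<close>

lemma sum_gram_squares_ge:
  fixes e :: "'i \<Rightarrow> 'a::real_inner"
  assumes "finite I"
  shows "(\<Sum>j\<in>I. e j \<bullet> e j)\<^sup>2 \<le> card I * (\<Sum>j\<in>I. \<Sum>l\<in>I. (e l \<bullet> e j) * (e l \<bullet> e j))"
proof -
  have "(\<Sum>j\<in>I. e j \<bullet> e j)\<^sup>2 \<le> (\<Sum>j\<in>I. (e j \<bullet> e j)\<^sup>2) * card I"
    using Cauchy_Schwarz_ineq_sum[of "\<lambda>j. e j \<bullet> e j" "\<lambda>_. 1" I] by simp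
  also have "\<dots> \<le> (\<Sum>j\<in>I. \<Sum>l\<in>I. (e l \<bullet> e j) * (e l \<bullet> e j)) * card I"
  proof (intro mult_right_mono sum_mono)
    fix j assume "j \<in> I"
    then show "(e j \<bullet> e j)\<^sup>2 \<le> (\<Sum>l\<in>I. (e l \<bullet> e j) * (e l \<bullet> e j))"
      using member_le_sum[of j I "\<lambda>l. (e l \<bullet> e j) * (e l \<bullet> e j)"] assms
      by (simp add: power2_eq_square)
  qed simp
  finally show ?thesis
    by (simp add: mult.commute)
qed

section \<open>The spread along the flow\<close>

lemma sum_deviation_zero:
  assumes "J > 0"
  shows "(\<Sum>j=1..J. v j - ens_mean J v) = 0"
  using assms by (simp add: ens_mean_def sum_subtractf sum_constant_scaleR del: sum_constant)

lemma sum_deviation_inner_const: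
  fixes v :: "nat \<Rightarrow> 'a::real_inner"
  assumes "J > 0"
  shows "(\<Sum>j=1..J. (v j - ens_mean J v) \<bullet> w) = 0"
  using sum_deviation_zero[OF assms, of v] by (simp flip: inner_sum_left)

lemma outer_mult_vec: "outer v w *v x = (w \<bullet> x) *\<^sub>R v"
  by (simp add: outer_def vec_eq_iff matrix_vector_mult_def inner_vec_def sum_distrib_left
      sum_distrib_right mult_ac)

lemma sum_matrix_vector_mult:
  fixes A :: "'i \<Rightarrow> real ^ 'n ^ 'm"
  shows "(\<Sum>i\<in>I. A i) *v x = (\<Sum>i\<in>I. A i *v x)"
  by (induction I rule: infinite_finite_induct) (auto simp: matrix_vector_mult_add_rdistrib)

lemma ens_cross_cov_mult_vec:
  "ens_cross_cov J v w *v x =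
    (1 / real J) *\<^sub>R (\<Sum>l=1..J. ((w l - ens_mean J w) \<bullet> x) *\<^sub>R (v l - ens_mean J v))"
  by (simp add: ens_cross_cov_def scaleR_matrix_vector_assoc[symmetric] sum_matrix_vector_mult
      outer_mult_vec)

lemma sum_deviation_inner_cross_cov:
  "(\<Sum>j=1..J. (v j - ens_mean J v) \<bullet> (ens_cross_cov J v w *v x j)) =
    (1 / real J) * (\<Sum>j=1..J. \<Sum>l=1..J.
      ((v l - ens_mean J v) \<bullet> (v j - ens_mean J v)) * ((w l - ens_mean J w) \<bullet> x j))"
  by (simp add: ens_cross_cov_mult_vec inner_sum_right sum_distrib_left inner_commute mult_ac)

lemma ens_spread_has_derivative:
  fixes u :: "real \<Rightarrow> nat \<Rightarrow> real ^ 'd"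
  assumes "J > 0"
    and "\<And>j. j \<in> {1..J} \<Longrightarrow> ((\<lambda>s. u s j) has_vector_derivative D j) (at t within S)"
  shows "((\<lambda>s. ens_spread J (u s)) has_real_derivative
    (1 / real J) * (\<Sum>j=1..J. (u t j - ens_mean J (u t)) \<bullet> D j)) (at t within S)"
proof -
  have d: "((\<lambda>s. u s j) has_derivative (\<lambda>h. h *\<^sub>R D j)) (at t within S)" if "j \<in> {1..J}" for j
    using assms(2)[OF that] by (simp add: has_vector_derivative_def)
  have "((\<lambda>s. (1 / real J) *\<^sub>R (\<Sum>j=1..J. u s j)) has_derivative
      (\<lambda>h. (1 / real J) *\<^sub>R (\<Sum>j=1..J. h *\<^sub>R D j))) (at t within S)"
    by (intro has_derivative_scaleR_right has_derivative_sum d)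
  moreover have "(1 / real J) *\<^sub>R (\<Sum>j=1..J. h *\<^sub>R D j) = h *\<^sub>R ens_mean J D" for h
    unfolding ens_mean_def scaleR_sum_right[symmetric] by (rule scaleR_left_commute)
  ultimately have m: "((\<lambda>s. ens_mean J (u s)) has_derivative (\<lambda>h. h *\<^sub>R ens_mean J D)) (at t within S)"
    by (simp only: ens_mean_def)
  define e where "e s j = u s j - ens_mean J (u s)" for s j
  have e: "((\<lambda>s. e s j) has_derivative (\<lambda>h. h *\<^sub>R D j - h *\<^sub>R ens_mean J D)) (at t within S)"
    if "j \<in> {1..J}" for j
    unfolding e_def by (intro has_derivative_diff d m that)
  have "((\<lambda>s. (1 / real J) * (\<Sum>j=1..J. (1 / 2) * (e s j \<bullet> e s j))) has_derivative
      (\<lambda>h. (1 / real J) * (\<Sum>j=1..J. (1 / 2) * (e t j \<bullet> (h *\<^sub>R D j - h *\<^sub>R ens_mean J D)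
        + (h *\<^sub>R D j - h *\<^sub>R ens_mean J D) \<bullet> e t j)))) (at t within S)"
    by (intro has_derivative_mult_right has_derivative_sum has_derivative_inner e)
  moreover have "(1 / 2) * (a \<bullet> b + b \<bullet> a) = a \<bullet> b" for a b :: "real ^ 'd"
    by (simp add: inner_commute)
  ultimately have "((\<lambda>s. ens_spread J (u s)) has_derivative
      (\<lambda>h. (1 / real J) * (\<Sum>j=1..J. (u t j - ens_mean J (u t)) \<bullet> (h *\<^sub>R D j - h *\<^sub>R ens_mean J D))))
      (at t within S)"
    by (simp only: ens_spread_def power2_norm_eq_inner e_def)
  moreover have "(\<Sum>j=1..J. (u t j - ens_mean J (u t)) \<bullet> (h *\<^sub>R D j - h *\<^sub>R ens_mean J D)) =
      (\<Sum>j=1..J. (u t j - ens_mean J (u t)) \<bullet> D j) * h" for h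
  proof -
    have "(\<Sum>j=1..J. (u t j - ens_mean J (u t)) \<bullet> (h *\<^sub>R D j - h *\<^sub>R ens_mean J D)) =
        (\<Sum>j=1..J. (u t j - ens_mean J (u t)) \<bullet> D j) * h -
        (\<Sum>j=1..J. (u t j - ens_mean J (u t)) \<bullet> (h *\<^sub>R ens_mean J D))"
      unfolding inner_diff_right sum_subtractf inner_scaleR_right sum_distrib_right
      by (simp only: mult.commute)
    then show ?thesis
      by (simp only: sum_deviation_inner_const[OF assms(1)] diff_zero)
  qed
  ultimately show ?thesis
    by (elim has_derivative_imp_has_field_derivative) (simp add: mult_ac)
qed

text \<open>The part \<open>K\<close> of the drift below, which contains the data, the mean and the constraints, is
  common to all particles, so it will not be seen by the spread. Inflation acts only on the
  deviations of the \<open>G\<close>-values and cancels the share \<open>r\<close> of their contribution.\<close>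

lemma eki_drift_split:
  obtains K where "\<And>j. eki_drift G y \<Gamma> C0 \<tau> m h J r v j =
    K - (1 - r) *\<^sub>R (ens_cross_cov J v (\<lambda>l. G (v l)) *v
          (matrix_inv \<Gamma> *v (G (v j) - ens_mean J (\<lambda>l. G (v l)))))
      - ens_cov J v *v (matrix_inv C0 *v (v j - ens_mean J v))"
proof -
  define K where "K = - (ens_cross_cov J v (\<lambda>l. G (v l)) *v
        (matrix_inv \<Gamma> *v (ens_mean J (\<lambda>l. G (v l)) - y)))
      - ens_cov J v *v (matrix_inv C0 *v ens_mean J v)
      + (1 / \<tau>) *\<^sub>R (ens_cov J v *v
          (\<Sum>i=1..m. (1 / h i (ens_mean J v)) *\<^sub>R grad (h i) (ens_mean J v)))"
  show ?thesis
    by (rule that[of K])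
      (simp add: K_def eki_drift_def Let_def matrix_vector_mult_diff_distrib algebra_simps)
qed

text \<open>The left-hand side is the derivative of the spread by \<open>ens_spread_has_derivative\<close>. The
  factor \<open>4\<close> appears because the spread is half the trace of the ensemble covariance, and
  it is the square of the trace that bounds the dissipation.\<close>

lemma spread_drift_le:
  fixes v :: "nat \<Rightarrow> real ^ 'd" and \<Gamma> :: "real ^ 'k ^ 'k"
  assumes "symmetric_pos_def \<Gamma>" and "symmetric_pos_def C0" and "J > 0" and "r \<le> 1"
  shows "(1 / real J) * (\<Sum>j=1..J. (v j - ens_mean J v) \<bullet> eki_drift G y \<Gamma> C0 \<tau> m h J r v j) \<le>
    - (4 * min_eigenvalue (matrix_inv C0) / real J) * (ens_spread J v)\<^sup>2"
proof -
  define e where "e j = v j - ens_mean J v" for j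
  define g where "g j = G (v j) - ens_mean J (\<lambda>l. G (v l))" for j
  define \<sigma> where "\<sigma> = min_eigenvalue (matrix_inv C0)"
  note P = symmetric_pos_def_inv[OF assms(1)] and Q = symmetric_pos_def_inv[OF assms(2)]
  define S where "S = (\<Sum>j=1..J. \<Sum>l=1..J. (e l \<bullet> e j) * (e l \<bullet> e j))"
  define SG where "SG = (\<Sum>j=1..J. \<Sum>l=1..J. (e l \<bullet> e j) * (g l \<bullet> (matrix_inv \<Gamma> *v g j)))"
  define SC where "SC = (\<Sum>j=1..J. \<Sum>l=1..J. (e l \<bullet> e j) * (e l \<bullet> (matrix_inv C0 *v e j)))"
  obtain K where K: "\<And>j. eki_drift G y \<Gamma> C0 \<tau> m h J r v j =
      K - (1 - r) *\<^sub>R (ens_cross_cov J v (\<lambda>l. G (v l)) *v (matrix_inv \<Gamma> *v g j))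
        - ens_cov J v *v (matrix_inv C0 *v e j)"
    unfolding e_def g_def using eki_drift_split by metis
  have "(\<Sum>j=1..J. e j \<bullet> eki_drift G y \<Gamma> C0 \<tau> m h J r v j) =
      (\<Sum>j=1..J. e j \<bullet> K)
      - (1 - r) * (\<Sum>j=1..J. e j \<bullet> (ens_cross_cov J v (\<lambda>l. G (v l)) *v (matrix_inv \<Gamma> *v g j)))
      - (\<Sum>j=1..J. e j \<bullet> (ens_cov J v *v (matrix_inv C0 *v e j)))"
    by (simp only: K inner_diff_right inner_scaleR_right sum_subtractf sum_distrib_left)
  also have "\<dots> = - (1 / real J) * ((1 - r) * SG + SC)"
    using sum_deviation_inner_const[OF assms(3), of v K]
      sum_deviation_inner_cross_cov[of v J "\<lambda>l. G (v l)" "\<lambda>j. matrix_inv \<Gamma> *v g j"]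
      sum_deviation_inner_cross_cov[of v J v "\<lambda>j. matrix_inv C0 *v e j"]
    unfolding ens_cov_def SG_def SC_def e_def[symmetric] g_def[symmetric]
    by (simp add: algebra_simps add_divide_distrib diff_divide_distrib)
  finally have drift: "(\<Sum>j=1..J. e j \<bullet> eki_drift G y \<Gamma> C0 \<tau> m h J r v j) =
      - (1 / real J) * ((1 - r) * SG + SC)" .
  have "0 \<le> x \<bullet> (matrix_inv \<Gamma> *v x)" for x
    using P unfolding symmetric_pos_def_def by (cases "x = 0") (auto intro: less_imp_le)
  then have "0 \<le> SG"
    using gram_weighted_form_ge[of "(*v) (matrix_inv \<Gamma>)" 0 e g "{1..J}"]
    by (simp add: SG_def)
  then have "0 \<le> (1 - r) * SG"
    using assms(4) by simp
  moreover have "\<sigma> * S \<le> SC"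
    unfolding S_def SC_def \<sigma>_def
    by (intro gram_weighted_form_ge min_eigenvalue_props Q) simp
  ultimately have low: "\<sigma> * S \<le> (1 - r) * SG + SC"
    by simp
  have spread: "2 * real J * ens_spread J v = (\<Sum>j=1..J. e j \<bullet> e j)"
    using assms(3) by (simp add: ens_spread_def e_def power2_norm_eq_inner sum_divide_distrib[symmetric])
  have "(2 * real J * ens_spread J v)\<^sup>2 \<le> real J * S"
    using sum_gram_squares_ge[of "{1..J}" e] by (simp add: spread S_def)
  then have "4 * real J * (ens_spread J v)\<^sup>2 \<le> S"
    using assms(3) by (simp add: power2_eq_square mult_ac)
  then have "\<sigma> * (4 * real J * (ens_spread J v)\<^sup>2) \<le> \<sigma> * S"
    using min_eigenvalue_props(1)[OF Q] by (intro mult_left_mono) (simp_all add: \<sigma>_def)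
  with low have "\<sigma> * (4 * real J * (ens_spread J v)\<^sup>2) \<le> (1 - r) * SG + SC"
    by linarith
  then have "\<sigma> * (4 * real J * (ens_spread J v)\<^sup>2) / (real J)\<^sup>2 \<le> ((1 - r) * SG + SC) / (real J)\<^sup>2"
    by (intro divide_right_mono) auto
  moreover have "\<sigma> * (4 * real J * (ens_spread J v)\<^sup>2) / (real J)\<^sup>2 =
      (4 * \<sigma> / real J) * (ens_spread J v)\<^sup>2"
    using assms(3) by (simp add: power2_eq_square)
  ultimately show ?thesis
    unfolding e_def[symmetric] drift \<sigma>_def[symmetric] by (simp add: power2_eq_square)
qed

section \<open>Comparison with the Riccati equation\<close>

text \<open>While \<open>f\<close> is positive, \<open>1 / f\<close> grows at rate at least \<open>c\<close>. As \<open>f\<close> is nonincreasing, it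
  is positive on all of \<open>[0, t]\<close> as soon as it is positive at \<open>t\<close>; otherwise there is
  nothing to prove.\<close>

lemma riccati_comparison:
  fixes f f' :: "real \<Rightarrow> real"
  assumes deriv: "\<And>t. t \<ge> 0 \<Longrightarrow> (f has_real_derivative f' t) (at t within {0..})"
    and le: "\<And>t. t \<ge> 0 \<Longrightarrow> f' t \<le> - c * (f t)\<^sup>2"
    and "c \<ge> 0" and "f 0 > 0" and "t \<ge> 0"
  shows "f t \<le> 1 / (c * t + inverse (f 0))"
proof (cases "f t > 0")
  case False
  moreover have "0 \<le> 1 / (c * t + inverse (f 0))"
    using assms(3-5) by simp
  ultimately show ?thesis
    by linarith
next
  case True
  have at: "(f has_real_derivative f' s) (at s)" if "s > 0" for s
    using deriv[of s] that at_within_interior[of s "{0..}"] by simp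
  have cont: "continuous_on {0..} f"
    using deriv by (auto intro: DERIV_continuous_on)
  have pos: "f s > 0" if "0 \<le> s" "s \<le> t" for s
  proof -
    have "f t \<le> f s"
    proof (rule DERIV_nonpos_imp_decreasing_open[OF that(2)])
      fix x assume "s < x" "x < t"
      moreover have "f' x \<le> 0" if "x > 0"
        using le[of x] that mult_nonneg_nonneg[OF assms(3) zero_le_power2[of "f x"]] by simp
      ultimately show "\<exists>y. (f has_real_derivative y) (at x) \<and> y \<le> 0"
        using at[of x] \<open>0 \<le> s\<close> by auto
    qed (use that cont in \<open>auto intro: continuous_on_subset\<close>)
    then show ?thesis
      using True by linarith
  qed
  have "inverse (f 0) - c * 0 \<le> inverse (f t) - c * t"
  proof (rule DERIV_nonneg_imp_increasing_open[OF assms(5)])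
    fix x assume x: "0 < x" "x < t"
    have fx: "f x > 0"
      using pos x by simp
    have "((\<lambda>s. inverse (f s) - c * s) has_real_derivative - (f' x) / (f x)\<^sup>2 - c) (at x)"
      using fx x
      by (auto intro!: derivative_eq_intros at simp: power2_eq_square divide_inverse)
    moreover have "0 \<le> - (f' x) / (f x)\<^sup>2 - c"
      using le[of x] x fx by (simp add: field_simps)
    ultimately show "\<exists>y. ((\<lambda>s. inverse (f s) - c * s) has_real_derivative y) (at x) \<and> 0 \<le> y"
      by blast
  next
    have "continuous_on {0..t} f"
      using cont by (rule continuous_on_subset) auto
    moreover have "\<forall>s\<in>{0..t}. f s \<noteq> 0"
      using pos by force
    ultimately show "continuous_on {0..t} (\<lambda>s. inverse (f s) - c * s)"
      by (intro continuous_intros)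
  qed
  then have "c * t + inverse (f 0) \<le> inverse (f t)"
    by simp
  moreover have "0 < c * t + inverse (f 0)"
    using assms(3-5) by (simp add: add_nonneg_pos)
  ultimately have "inverse (inverse (f t)) \<le> inverse (c * t + inverse (f 0))"
    by (rule le_imp_inverse_le)
  then show ?thesis
    by (simp add: inverse_eq_divide)
qed

section \<open>Decay of the spread\<close>

theorem lemma3p1:
  fixes G :: "real ^ 'd \<Rightarrow> real ^ 'k"
    and y :: "real ^ 'k"
    and \<Gamma> :: "real ^ 'k ^ 'k"
    and C0 :: "real ^ 'd ^ 'd"
    and h :: "nat \<Rightarrow> real ^ 'd \<Rightarrow> real"
    and m J :: nat
    and \<tau> :: real
    and \<rho> :: "real \<Rightarrow> real"
    and u :: "real \<Rightarrow> nat \<Rightarrow> real ^ 'd"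
  assumes "symmetric_pos_def \<Gamma>" and "symmetric_pos_def C0"
    and "\<And>i. i \<in> {1..m} \<Longrightarrow> convex_on UNIV (h i)"
    and "\<And>i. i \<in> {1..m} \<Longrightarrow> continuously_differentiable (h i)"
    and "\<exists>x. \<forall>i\<in>{1..m}. h i x < 0"
    and "\<tau> > 0" and "J \<ge> 2"
    and "\<And>t. t \<ge> 0 \<Longrightarrow> 0 \<le> \<rho> t \<and> \<rho> t \<le> 1" and "(\<rho> \<longlongrightarrow> 1) at_top"
    and "\<And>j. j \<in> {1..J} \<Longrightarrow> u 0 j \<in> feasible_set m h"
    and "eki_solution G y \<Gamma> C0 \<tau> m h J \<rho> u"
    and "ens_spread J (u 0) > 0"
  shows "\<forall>t\<ge>0. ens_spread J (u t) \<le>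
           1 / (2 * min_eigenvalue (matrix_inv C0) / real J * t + inverse (ens_spread J (u 0)))"
proof (intro allI impI)
  fix t :: real assume t: "t \<ge> 0"
  define \<sigma> where "\<sigma> = min_eigenvalue (matrix_inv C0)"
  have \<sigma>: "\<sigma> > 0"
    unfolding \<sigma>_def using assms(2) by (intro min_eigenvalue_props symmetric_pos_def_inv)
  have J: "J > 0"
    using assms(7) by simp
  define V' where "V' s = (1 / real J) * (\<Sum>j=1..J. (u s j - ens_mean J (u s)) \<bullet>
      eki_drift G y \<Gamma> C0 \<tau> m h J (\<rho> s) (u s) j)" for s
  have "ens_spread J (u t) \<le> 1 / (2 * \<sigma> / real J * t + inverse (ens_spread J (u 0)))"
  proof (rule riccati_comparison[of "\<lambda>s. ens_spread J (u s)" V'])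
    fix s :: real assume s: "s \<ge> 0"
    show "((\<lambda>s. ens_spread J (u s)) has_real_derivative V' s) (at s within {0..})"
      unfolding V'_def using assms(11) s
      by (intro ens_spread_has_derivative J) (auto simp: eki_solution_def)
    have "V' s \<le> - (4 * \<sigma> / real J) * (ens_spread J (u s))\<^sup>2"
      unfolding V'_def \<sigma>_def using assms(8)[OF s] by (intro spread_drift_le assms(1,2) J) simp
    \<comment> \<open>Half of the dissipation already gives the asserted rate.\<close>
    also have "\<dots> \<le> - (2 * \<sigma> / real J) * (ens_spread J (u s))\<^sup>2"
      using \<sigma> by (intro mult_right_mono) (auto intro!: divide_right_mono)
    finally show "V' s \<le> - (2 * \<sigma> / real J) * (ens_spread J (u s))\<^sup>2" .
  qed (use \<sigma> t assms(12) in auto)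
  then show "ens_spread J (u t) \<le>
      1 / (2 * min_eigenvalue (matrix_inv C0) / real J * t + inverse (ens_spread J (u 0)))"
    by (simp only: \<sigma>_def)
qed

end
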